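(* Suppose that $f\in L^1(\mathbb T^2)$ and let $k=(k_1,k_2)\in\mathbb Z^2$. If $k\neq 0$ and $v\in\mathbb Z^2\setminus\{0\}$ satisfies $v\perp k$, then $$\hat f(k)=\int_0^1 I_vf(0,y)\exp(-2\pi i k_2y)\,dy\quad\text{if } k_2\neq 0,$$ $$\hat f(k)=\int_0^1 I_vf(x,0)\exp(-2\pi i k_1x)\,dx\quad\text{if } k_1\neq 0.$$ If $k=0$, then $$\hat f(k)=\int_0^1 I_{(1,0)}f(0,y)\,dy=\int_0^1 I_{(0,1)}f(x,0)\,dx.$$
   Context: $\mathbb T^2=\mathbb R^2/\mathbb Z^2$ is the flat torus; functions on $\mathbb T^2$ are identified with $\mathbb Z^2$-periodic functions on $\mathbb R^2$. The Fourier coefficients of $f$ are $\hat f(k)=\int_{[0,1]^2}f(x)e^{-2\pi i k\cdot x}\,dx$, $k\in\mathbb Z^2$. For $v\in\mathbb Z^2\setminus\{0\}$ the X-ray transform in direction $v$ is $I_vf(x)=If(x,v)=\int_0^1 f(x+tv)\,dt$. For $f\in L^1(\mathbb T^2)$ the values $I_vf(0,y)$ and $I_vf(x,0)$ in the formulas are given by this integral for almost every $y$, respectively almost every $x$, in $[0,1]$. *)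

theory Defs
  imports "HOL-Analysis.Analysis"
begin

definition of_lattice :: "int \<times> int \<Rightarrow> real \<times> real" where
  "of_lattice m = (real_of_int (fst m), real_of_int (snd m))"

definition unit_square :: "(real \<times> real) set" where
  "unit_square = {0..1} \<times> {0..1}"

text \<open>
  Functions on the torus are functions on the plane that are periodic with respect to the integer
  lattice. An element of $L^1$ is given by an everywhere periodic, Lebesgue measurable
  representative.
\<close>

definition lattice_periodic :: "(real \<times> real \<Rightarrow> complex) \<Rightarrow> bool" where
  "lattice_periodic f \<longleftrightarrow> (\<forall>x m. f (x + of_lattice m) = f x)"

definition L1_torus :: "(real \<times> real \<Rightarrow> complex) set" where
  "L1_torus = {f. lattice_periodic f \<and> integrable (lebesgue_on unit_square) f}"

definition fourier_coeff :: "(real \<times> real \<Rightarrow> complex) \<Rightarrow> int \<times> int \<Rightarrow> complex" where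
  "fourier_coeff f k =
     (LINT x|lebesgue_on unit_square.
        f x * exp (- 2 * complex_of_real pi * \<i> * complex_of_real (of_lattice k \<bullet> x)))"

text \<open>
  For $f \in L^1$ the integrand of the X-ray transform need not be integrable for every base
  point. The Bochner integral is 0 there, so statements about \<open>xray\<close> are accompanied by
  \<open>xray_exists\<close> where it matters.
\<close>

definition xray_exists :: "int \<times> int \<Rightarrow> (real \<times> real \<Rightarrow> complex) \<Rightarrow> real \<times> real \<Rightarrow> bool" where
  "xray_exists v f x \<longleftrightarrow> integrable (lebesgue_on {0..1}) (\<lambda>t. f (x + t *\<^sub>R of_lattice v))"

definition xray :: "int \<times> int \<Rightarrow> (real \<times> real \<Rightarrow> complex) \<Rightarrow> real \<times> real \<Rightarrow> complex" where
  "xray v f x = (LINT t|lebesgue_on {0..1}. f (x + t *\<^sub>R of_lattice v))"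

end

theory Submission
  imports Defs
begin

text \<open>
  The theorem is the Fourier slice theorem on the torus. Since \<open>v\<close> is orthogonal to \<open>k\<close>, the
  character \<open>x \<mapsto> exp (- 2 * pi * \<i> * (k \<bullet> x))\<close> is constant along every line in direction \<open>v\<close>.
  Multiplying the X-ray transform by the character at the base point is therefore the same as
  integrating the periodic function \<open>h = f * fourier_char k\<close> along the line. It remains to see
  that the iterated integral of \<open>h (t * v\<^sub>1, y + t * v\<^sub>2)\<close> over \<open>t\<close> and \<open>y\<close> in \<open>[0, 1]\<close> is the
  integral of \<open>h\<close> over the unit square. If \<open>k\<^sub>2 \<noteq> 0\<close>, then orthogonality forces \<open>v\<^sub>1 \<noteq> 0\<close>, and then the
  map \<open>(y, t) \<mapsto> (t * v\<^sub>1, y + t * v\<^sub>2)\<close>, reduced modulo 1, preserves Lebesgue measure on the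
  unit square (\<open>skew_toral_map_measure_preserving\<close>): for fixed \<open>t\<close> it rotates the circle in the
  variable \<open>y\<close>, and \<open>t \<mapsto> t * v\<^sub>1\<close> is a \<open>\<bar>v\<^sub>1\<bar>\<close>-to-one covering of the circle. The formula in the other
  coordinate, where \<open>v\<^sub>2 \<noteq> 0\<close>, comes from exchanging the two factors, and for \<open>k = 0\<close> every
  direction is orthogonal to \<open>k\<close>.

  Measure preservation and Fubini's theorem (\<open>fubini_measure_preserving\<close>) give at once the
  existence of almost every line integral, the integrability of the outer integrand and the value
  of the double integral. Fubini's theorem holds for product measures, whereas Lebesgue measure on
  the plane is only the completion of one. Hence \<open>h\<close> is first replaced by a Borel function that
  agrees with it almost everywhere; the exceptional null set stays null under the
  measure-preserving map, and almost all of its slices are null.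
\<close>

section \<open>Lebesgue and Borel versions of restricted Lebesgue measure\<close>

text \<open>
  As a density on the whole space, the measure keeps the Borel sigma-algebra of the whole space,
  so measurability does not have to be relativised to \<open>S\<close>.
\<close>

abbreviation lborel_on :: "'a::euclidean_space set \<Rightarrow> 'a measure" where
  "lborel_on S \<equiv> density lborel (indicator S)"

lemma AE_lebesgue_on_iff:
  assumes "S \<in> sets borel"
  shows "(AE x in lebesgue_on S. P x) \<longleftrightarrow> (AE x in lborel_on S. P x)"
  using assms by (simp add: AE_restrict_space_iff AE_completion_iff AE_density indicator_def)

lemma lborel_on_eq_lebesgue_on:
  fixes g :: "'a::euclidean_space \<Rightarrow> 'b::{banach, second_countable_topology}"
  assumes "S \<in> sets borel" "g \<in> borel_measurable borel"
  shows "integrable (lborel_on S) g \<longleftrightarrow> integrable (lebesgue_on S) g"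
    and "integral\<^sup>L (lborel_on S) g = integral\<^sup>L (lebesgue_on S) g"
proof -
  have "lborel_on S = density lborel (\<lambda>x. ennreal (indicator S x))"
    by (simp add: ennreal_indicator)
  then show "integrable (lborel_on S) g \<longleftrightarrow> integrable (lebesgue_on S) g"
    "integral\<^sup>L (lborel_on S) g = integral\<^sup>L (lebesgue_on S) g"
    using assms by (simp_all add: integrable_density integral_density integrable_restrict_space
        integral_restrict_space integrable_completion integral_completion)
qed

text \<open>
  Completeness of Lebesgue measure makes \<open>h\<close> measurable although only \<open>g\<close> is assumed to be. This
  is how results obtained for Borel functions return to Lebesgue measurable ones.
\<close>

lemma lebesgue_on_integral_cong_AE:
  fixes g :: "'a::euclidean_space \<Rightarrow> complex"
  assumes S: "S \<in> sets borel" and g: "integrable (lborel_on S) g"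
    and eq: "AE x in lborel_on S. h x = g x"
  shows "integrable (lebesgue_on S) h"
    and "integral\<^sup>L (lebesgue_on S) h = integral\<^sup>L (lborel_on S) g"
proof -
  have [measurable]: "g \<in> borel_measurable borel"
    using borel_measurable_integrable[OF g] by simp
  have gi: "integrable (lebesgue_on S) g"
    using lborel_on_eq_lebesgue_on(1)[OF S, of g] g by simp
  have eq': "AE x in lebesgue_on S. h x = g x"
    using eq by (simp add: AE_lebesgue_on_iff[OF S])
  have h: "h \<in> borel_measurable (lebesgue_on S)"
  proof (rule borel_measurable_if_D, rule borel_measurable_AE)
    show "(\<lambda>x. if x \<in> S then g x else 0) \<in> borel_measurable lebesgue"
      using gi S by (intro borel_measurable_if_I) auto
    show "AE x in lebesgue. (if x \<in> S then g x else 0) = (if x \<in> S then h x else 0)"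
      using eq' S by (auto simp: AE_restrict_space_iff elim!: eventually_mono)
  qed
  show "integrable (lebesgue_on S) h"
    using integrable_cong_AE[OF h borel_measurable_integrable[OF gi] eq'] gi by simp
  show "integral\<^sup>L (lebesgue_on S) h = integral\<^sup>L (lborel_on S) g"
    using integral_cong_AE[OF h borel_measurable_integrable[OF gi] eq']
      lborel_on_eq_lebesgue_on(2)[OF S, of g] by simp
qed

lemma lebesgue_on_borel_representative:
  fixes h :: "'a::euclidean_space \<Rightarrow> complex"
  assumes S: "S \<in> sets borel" and h: "integrable (lebesgue_on S) h"
  obtains g where "integrable (lborel_on S) g" "AE x in lborel_on S. h x = g x"
    "integral\<^sup>L (lborel_on S) g = integral\<^sup>L (lebesgue_on S) h"
proof -
  have "(\<lambda>x. if x \<in> S then h x else 0) \<in> borel_measurable lebesgue"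
    using S h by (intro borel_measurable_if_I) auto
  then have "(\<lambda>x. Re (if x \<in> S then h x else 0)) \<in> borel_measurable lebesgue"
    "(\<lambda>x. Im (if x \<in> S then h x else 0)) \<in> borel_measurable lebesgue"
    by measurable
  from this[THEN completion_ex_borel_measurable_real] obtain r i
    where [measurable]: "r \<in> borel_measurable lborel" "i \<in> borel_measurable lborel"
      and "AE x in lborel. Re (if x \<in> S then h x else 0) = r x"
        "AE x in lborel. Im (if x \<in> S then h x else 0) = i x"
    by blast
  define g where "g x = Complex (r x) (i x)" for x
  have gm[measurable]: "g \<in> borel_measurable borel"
    unfolding borel_measurable_complex_iff g_def by simp
  have "AE x in lborel. (if x \<in> S then h x else 0) = g x"
    using \<open>AE x in lborel. Re _ = r x\<close> \<open>AE x in lborel. Im _ = i x\<close>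
    by eventually_elim (auto simp: g_def complex_eq_iff)
  then have "AE x in lborel. x \<in> S \<longrightarrow> h x = g x"
    by eventually_elim auto
  then have eq: "AE x in lborel_on S. h x = g x"
    using S by (simp add: AE_density indicator_def)
  then have "AE x in lebesgue_on S. h x = g x"
    by (simp add: AE_lebesgue_on_iff[OF S])
  moreover have "g \<in> borel_measurable (lebesgue_on S)"
    by (intro measurable_restrict_space1 measurable_completion) simp
  ultimately have "integrable (lebesgue_on S) g"
    using h integrable_cong_AE borel_measurable_integrable by blast
  then have "integrable (lborel_on S) g"
    using lborel_on_eq_lebesgue_on(1)[OF S gm] by simp
  with eq show ?thesis
    using that lebesgue_on_integral_cong_AE(2)[OF S _ eq] by metis
qed

section \<open>Rotations and coverings of the circle\<close>

text \<open>
  Closed intervals match \<open>unit_square\<close> and the domain of the X-ray integral, whereas half-open ones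
  are fundamental domains. The two differ by a null set.
\<close>

abbreviation unit_lborel :: "real measure" where
  "unit_lborel \<equiv> lborel_on {0..1}"

lemma borel_measurable_frac [measurable]: "(frac :: real \<Rightarrow> real) \<in> borel_measurable borel"
  unfolding frac_def[abs_def] by measurable

lemma nn_integral_unit_lborel:
  assumes [measurable]: "q \<in> borel_measurable borel"
  shows "(\<integral>\<^sup>+x. q x \<partial>unit_lborel) = (\<integral>\<^sup>+x. q x * indicator {0..<1} x \<partial>lborel)"
proof -
  have "(\<integral>\<^sup>+x. q x \<partial>unit_lborel) = (\<integral>\<^sup>+x. indicator {0..1} x * q x \<partial>lborel)"
    by (rule nn_integral_density) auto
  also have "\<dots> = (\<integral>\<^sup>+x. q x * indicator {0..<1} x \<partial>lborel)"
    by (rule nn_integral_cong_AE)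
       (use AE_lborel_singleton[of "1::real"] in eventually_elim, auto split: split_indicator)
  finally show ?thesis .
qed

text \<open>
  Cutting \<open>[c, c + 1)\<close> at the integer that it contains and translating the pieces by integers
  rearranges it to \<open>[0, 1)\<close>; an interval of length \<open>L\<close> consists of \<open>L\<close> such pieces.
\<close>

lemma nn_integral_periodic_interval:
  fixes q :: "real \<Rightarrow> ennreal" and c :: real and L :: nat
  assumes [measurable]: "q \<in> borel_measurable borel" and per: "\<And>x. q (x + 1) = q x"
  shows "(\<integral>\<^sup>+x. q x * indicator {c..<c + L} x \<partial>lborel)
       = L * (\<integral>\<^sup>+x. q x * indicator {0..<1} x \<partial>lborel)"
proof -
  define J where "J a b = (\<integral>\<^sup>+x. q x * indicator {a..<b} x \<partial>lborel)" for a b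
  have shift: "J (a + 1) (b + 1) = J a b" for a b
    unfolding J_def
    by (subst nn_integral_real_affine[where c = 1 and t = 1])
       (auto simp: add.commute[of 1] per intro!: nn_integral_cong split: split_indicator)
  have add: "J a b + J b d = J a d" if "a \<le> b" "b \<le> d" for a b d
    unfolding J_def using that
    by (subst nn_integral_add[symmetric]) (auto intro!: nn_integral_cong split: split_indicator)
  have shift_nat: "J (a + real n) (b + real n) = J a b" for a b n
  proof (induction n)
    case (Suc n)
    then show ?case using shift[of "a + real n" "b + real n"] by (simp add: ac_simps)
  qed simp
  have shift_int: "J (a + of_int n) (b + of_int n) = J a b" for a b n
  proof (cases "n \<ge> 0")
    case True
    then show ?thesis using shift_nat[of a "nat n" b] by simp
  next
    case False
    then show ?thesis using shift_nat[of "a + of_int n" "nat (- n)" "b + of_int n"] by simp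
  qed
  have one: "J c (c + 1) = J 0 1" for c
  proof -
    have f: "0 \<le> frac c" "frac c \<le> 1" using frac_lt_1[of c] by auto
    have "J c (c + 1) = J (frac c + of_int \<lfloor>c\<rfloor>) (frac c + 1 + of_int \<lfloor>c\<rfloor>)"
      by (simp add: frac_def)
    also have "\<dots> = J (frac c) (frac c + 1)" by (rule shift_int)
    also have "\<dots> = J (frac c) 1 + J (0 + 1) (frac c + 1)"
      using f by (simp add: add)
    also have "\<dots> = J 0 1" unfolding shift using f by (simp add: add add.commute)
    finally show ?thesis .
  qed
  have "J c (c + real L) = of_nat L * J 0 1"
  proof (induction L)
    case 0
    then show ?case by (simp add: J_def)
  next
    case (Suc L)
    have "J c (c + real (Suc L)) = J c (c + real L) + J (c + real L) (c + real L + 1)"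
      by (subst add) (auto simp: ac_simps)
    also have "\<dots> = of_nat (Suc L) * J 0 1"
      unfolding Suc.IH one by (simp add: distrib_right add.commute)
    finally show ?case .
  qed
  then show ?thesis by (simp add: J_def)
qed

lemma nn_integral_rotation:
  fixes c :: real
  assumes [measurable]: "p \<in> borel_measurable borel"
  shows "(\<integral>\<^sup>+x. p (frac (x + c)) \<partial>unit_lborel) = (\<integral>\<^sup>+x. p x \<partial>unit_lborel)"
proof -
  have "(\<integral>\<^sup>+x. p (frac (x + c)) \<partial>unit_lborel)
      = (\<integral>\<^sup>+x. p (frac (c + 1 * x)) * indicator {c..<c + real 1} (c + 1 * x) \<partial>lborel)"
    by (subst nn_integral_unit_lborel)
       (auto intro!: nn_integral_cong simp: add.commute split: split_indicator)
  also have "\<dots> = (\<integral>\<^sup>+x. p (frac x) * indicator {c..<c + real 1} x \<partial>lborel)"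
    by (subst nn_integral_real_affine[where c = 1 and t = c
          and f = "\<lambda>x. p (frac x) * indicator {c..<c + real 1} x"]) auto
  also have "\<dots> = (\<integral>\<^sup>+x. p (frac x) * indicator {0..<1} x \<partial>lborel)"
    by (subst nn_integral_periodic_interval) (auto simp: frac_1_eq)
  also have "\<dots> = (\<integral>\<^sup>+x. p x \<partial>unit_lborel)"
    by (auto simp: nn_integral_unit_lborel intro!: nn_integral_cong split: split_indicator)
  finally show ?thesis .
qed

text \<open>
  The substitution \<open>s = a * x\<close> turns the left-hand side into \<open>1 / \<bar>a\<bar>\<close> times the integral of a periodic
  function over an interval of length \<open>\<bar>a\<bar>\<close>.
\<close>

lemma nn_integral_dilation:
  fixes a :: int
  assumes [measurable]: "p \<in> borel_measurable borel" and "a \<noteq> 0"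
  shows "(\<integral>\<^sup>+x. p (frac (of_int a * x)) \<partial>unit_lborel) = (\<integral>\<^sup>+x. p x \<partial>unit_lborel)"
proof -
  \<comment> \<open>The interval \<open>[c, c + L)\<close> is the image of the unit interval, up to end points, for either sign
    of \<open>a\<close>.\<close>
  define c where "c = min 0 (real_of_int a)"
  define L where "L = nat \<bar>a\<bar>"
  have L: "real L = \<bar>real_of_int a\<bar>" "L > 0" using \<open>a \<noteq> 0\<close> by (auto simp: L_def)
  have "ennreal \<bar>real_of_int a\<bar> * (\<integral>\<^sup>+x. p (frac (of_int a * x)) \<partial>unit_lborel)
      = ennreal \<bar>real_of_int a\<bar> *
        (\<integral>\<^sup>+x. p (frac (0 + of_int a * x)) * indicator {c..<c + real L} (0 + of_int a * x) \<partial>lborel)"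
  proof (subst nn_integral_density, simp, simp, rule arg_cong, rule nn_integral_cong_AE)
    show "AE x in lborel. indicator {0..1} x * p (frac (of_int a * x))
        = p (frac (0 + of_int a * x)) * indicator {c..<c + real L} (0 + of_int a * x)"
      using AE_lborel_singleton[of "0::real"] AE_lborel_singleton[of "1::real"]
    proof eventually_elim
      case (elim x)
      have "x \<in> {0..1} \<longleftrightarrow> of_int a * x \<in> {c..<c + real L}"
      proof (cases "a > 0")
        case True
        then show ?thesis using elim by (auto simp: c_def L zero_le_mult_iff)
      next
        case False
        then show ?thesis using \<open>a \<noteq> 0\<close> elim by (auto simp: c_def L mult_less_0_iff)
      qed
      then show ?case by (auto simp: indicator_def)
    qed
  qed
  also have "\<dots> = (\<integral>\<^sup>+x. p (frac x) * indicator {c..<c + real L} x \<partial>lborel)"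
    by (subst nn_integral_real_affine[where c = "of_int a" and t = 0
          and f = "\<lambda>x. p (frac x) * indicator {c..<c + real L} x"]) (use \<open>a \<noteq> 0\<close> in auto)
  also have "\<dots> = L * (\<integral>\<^sup>+x. p (frac x) * indicator {0..<1} x \<partial>lborel)"
    by (rule nn_integral_periodic_interval) (auto simp: frac_1_eq)
  also have "(\<integral>\<^sup>+x. p (frac x) * indicator {0..<1} x \<partial>lborel) = (\<integral>\<^sup>+x. p x \<partial>unit_lborel)"
    by (auto simp: nn_integral_unit_lborel intro!: nn_integral_cong split: split_indicator)
  finally show ?thesis
    using L(2) by (simp add: ennreal_mult_cancel_left ennreal_of_nat_eq_real_of_nat flip: L(1))
qed

section \<open>Measure-preserving maps of the unit square\<close>

interpretation unit_lborel: finite_measure unit_lborel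
  by (rule finite_measureI) (simp add: emeasure_density)

interpretation unit_pair: pair_sigma_finite unit_lborel unit_lborel ..

lemma lborel_on_unit_square: "lborel_on unit_square = unit_lborel \<Otimes>\<^sub>M unit_lborel"
proof -
  have "unit_lborel \<Otimes>\<^sub>M unit_lborel
      = density (lborel \<Otimes>\<^sub>M lborel) (\<lambda>(x, y). indicator {0..1} x * indicator {0..1} y)"
    by (intro pair_measure_density lborel.sigma_finite_measure_axioms
        unit_lborel.sigma_finite_measure_axioms) measurable
  also have "(\<lambda>(x, y). indicator {0..1::real} x * indicator {0..1::real} y :: ennreal)
      = indicator unit_square"
    by (auto simp: unit_square_def indicator_def fun_eq_iff)
  finally show ?thesis by (simp add: lborel_prod)
qed

text \<open>
  The variable \<open>y\<close> is integrated first: there the second component is a rotation by \<open>b * t\<close> and the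
  first is constant. What remains is a function of \<open>frac (a * t)\<close>. The base point \<open>y\<close> is nevertheless
  the first argument of \<open>\<phi>\<close>, because later the line integral in \<open>t\<close> is the inner one.
\<close>

lemma skew_toral_map_measure_preserving:
  fixes a b :: int
  assumes "a \<noteq> 0"
  defines "\<phi> \<equiv> \<lambda>(y, t). (frac (of_int a * t), frac (y + of_int b * t))"
  shows "\<phi> \<in> borel \<rightarrow>\<^sub>M borel"
    and "distr (lborel_on unit_square) borel \<phi> = lborel_on unit_square"
proof -
  have \<phi>': "\<phi> \<in> borel \<Otimes>\<^sub>M borel \<rightarrow>\<^sub>M borel \<Otimes>\<^sub>M borel"
    unfolding \<phi>_def split_beta' by measurable
  then show \<phi>[measurable]: "\<phi> \<in> borel \<rightarrow>\<^sub>M borel"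
    by (simp add: borel_prod)
  show "distr (lborel_on unit_square) borel \<phi> = lborel_on unit_square"
  proof (rule measure_eqI)
    fix A assume "A \<in> sets (distr (lborel_on unit_square) borel \<phi>)"
    then have [measurable]: "A \<in> sets (borel :: (real \<times> real) measure)" by simp
    define F :: "real \<times> real \<Rightarrow> ennreal" where "F = indicator A"
    have "F \<in> borel_measurable borel" unfolding F_def by measurable
    then have F[measurable]: "F \<in> borel_measurable (borel \<Otimes>\<^sub>M borel)"
      by (simp add: borel_prod)
    have [measurable]: "(\<lambda>z. F (\<phi> z)) \<in> borel_measurable (borel \<Otimes>\<^sub>M borel)"
      using \<phi>' F by (rule measurable_compose)
    have pair: "sets (unit_lborel \<Otimes>\<^sub>M unit_lborel) = sets (borel \<Otimes>\<^sub>M borel)"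
      by (intro sets_pair_measure_cong) simp_all
    have "emeasure (distr (lborel_on unit_square) borel \<phi>) A
        = (\<integral>\<^sup>+z. F z \<partial>distr (lborel_on unit_square) borel \<phi>)"
      by (simp add: F_def)
    also have "\<dots> = (\<integral>\<^sup>+z. F (\<phi> z) \<partial>lborel_on unit_square)"
      by (rule nn_integral_distr) (auto simp: F_def)
    also have "\<dots> = (\<integral>\<^sup>+t. (\<integral>\<^sup>+y. F (\<phi> (y, t)) \<partial>unit_lborel) \<partial>unit_lborel)"
      unfolding lborel_on_unit_square
      by (rule unit_pair.nn_integral_snd[symmetric]) (simp add: measurable_cong_sets[OF pair])
    also have "\<dots> = (\<integral>\<^sup>+t. (\<integral>\<^sup>+y. F (frac (of_int a * t), y) \<partial>unit_lborel) \<partial>unit_lborel)"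
      unfolding \<phi>_def prod.case
      by (intro nn_integral_cong nn_integral_rotation) measurable
    also have "\<dots> = (\<integral>\<^sup>+x. (\<integral>\<^sup>+y. F (x, y) \<partial>unit_lborel) \<partial>unit_lborel)"
      by (rule nn_integral_dilation[OF _ assms(1),
            of "\<lambda>x. \<integral>\<^sup>+y. F (x, y) \<partial>unit_lborel"]) measurable
    also have "\<dots> = (\<integral>\<^sup>+z. F z \<partial>lborel_on unit_square)"
      unfolding lborel_on_unit_square
      by (rule unit_lborel.nn_integral_fst) (simp add: measurable_cong_sets[OF pair])
    finally show "emeasure (distr (lborel_on unit_square) borel \<phi>) A
        = emeasure (lborel_on unit_square) A"
      by (simp add: F_def)
  qed simp
qed

lemma swap_measure_preserving:
  "distr (lborel_on unit_square) borel prod.swap = lborel_on unit_square"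
proof -
  have "sets (unit_lborel \<Otimes>\<^sub>M unit_lborel) = sets borel"
    using arg_cong[OF lborel_on_unit_square, of sets] by (simp only: sets_density sets_lborel)
  then have "distr (unit_lborel \<Otimes>\<^sub>M unit_lborel) borel prod.swap
      = distr (unit_lborel \<Otimes>\<^sub>M unit_lborel) (unit_lborel \<Otimes>\<^sub>M unit_lborel) (\<lambda>(x, y). (y, x))"
    by (intro distr_cong) auto
  then show ?thesis
    using unit_pair.distr_pair_swap by (simp add: lborel_on_unit_square)
qed

text \<open>
  Since \<open>\<phi>\<close> pulls null sets back to null sets, \<open>h\<close> composed with \<open>\<phi>\<close> agrees almost everywhere with a
  Borel function, to which the product-measure form of Fubini's theorem applies.
\<close>

lemma fubini_measure_preserving:
  fixes h :: "real \<times> real \<Rightarrow> complex"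
  assumes h: "integrable (lebesgue_on unit_square) h"
    and \<phi>[measurable]: "\<phi> \<in> borel \<rightarrow>\<^sub>M borel"
    and distr: "distr (lborel_on unit_square) borel \<phi> = lborel_on unit_square"
  shows "AE y in lebesgue_on {0..1}. integrable (lebesgue_on {0..1}) (\<lambda>t. h (\<phi> (y, t)))"
    and "integrable (lebesgue_on {0..1}) (\<lambda>y. LINT t|lebesgue_on {0..1}. h (\<phi> (y, t)))"
    and "(LINT y|lebesgue_on {0..1}. LINT t|lebesgue_on {0..1}. h (\<phi> (y, t)))
      = integral\<^sup>L (lebesgue_on unit_square) h"
proof -
  have Q: "unit_square \<in> sets borel" and I: "{0..1::real} \<in> sets borel"
    by (auto simp: unit_square_def intro!: borel_closed closed_Times)
  obtain g where g: "integrable (lborel_on unit_square) g"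
    and ae: "AE x in lborel_on unit_square. h x = g x"
    and int: "integral\<^sup>L (lborel_on unit_square) g = integral\<^sup>L (lebesgue_on unit_square) h"
    using lebesgue_on_borel_representative[OF Q h] .
  have [measurable]: "g \<in> borel_measurable borel"
    using borel_measurable_integrable[OF g] by simp
  have m: "\<phi> \<in> lborel_on unit_square \<rightarrow>\<^sub>M borel" by simp
  have G: "integrable (unit_lborel \<Otimes>\<^sub>M unit_lborel) (\<lambda>z. g (\<phi> z))"
    using integrable_distr[OF m, of g] g unfolding distr by (simp add: lborel_on_unit_square)
  have intG: "integral\<^sup>L (unit_lborel \<Otimes>\<^sub>M unit_lborel) (\<lambda>z. g (\<phi> z))
      = integral\<^sup>L (lebesgue_on unit_square) h"
    using integral_distr[OF m, of g] unfolding distr int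
    by (simp add: lborel_on_unit_square)
  have "AE z in lborel_on unit_square. h (\<phi> z) = g (\<phi> z)"
    using AE_distrD[OF m, of "\<lambda>x. h x = g x"] ae unfolding distr by simp
  then have "AE z in unit_lborel \<Otimes>\<^sub>M unit_lborel. h (\<phi> z) = g (\<phi> z)"
    unfolding lborel_on_unit_square .
  then have "AE y in unit_lborel. AE t in unit_lborel. h (\<phi> (y, t)) = g (\<phi> (y, t))"
    by (rule unit_pair.AE_pair)
  moreover have "AE y in unit_lborel. integrable unit_lborel (\<lambda>t. g (\<phi> (y, t)))"
    by (rule unit_pair.AE_integrable_fst'[OF G])
  ultimately have slices: "AE y in unit_lborel.
      integrable (lebesgue_on {0..1}) (\<lambda>t. h (\<phi> (y, t))) \<and>
      (LINT t|lebesgue_on {0..1}. h (\<phi> (y, t))) = (LINT t|unit_lborel. g (\<phi> (y, t)))"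
    by eventually_elim (blast intro: lebesgue_on_integral_cong_AE[OF I])
  then show "AE y in lebesgue_on {0..1}. integrable (lebesgue_on {0..1}) (\<lambda>t. h (\<phi> (y, t)))"
    unfolding AE_lebesgue_on_iff[OF I] by eventually_elim blast
  have eq: "AE y in unit_lborel.
      (LINT t|lebesgue_on {0..1}. h (\<phi> (y, t))) = (LINT t|unit_lborel. g (\<phi> (y, t)))"
    using slices by eventually_elim blast
  have outer: "integrable unit_lborel (\<lambda>y. LINT t|unit_lborel. g (\<phi> (y, t)))"
    by (rule unit_pair.integrable_fst'[OF G])
  show "integrable (lebesgue_on {0..1}) (\<lambda>y. LINT t|lebesgue_on {0..1}. h (\<phi> (y, t)))"
    by (rule lebesgue_on_integral_cong_AE(1)[OF I outer eq])
  show "(LINT y|lebesgue_on {0..1}. LINT t|lebesgue_on {0..1}. h (\<phi> (y, t)))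
      = integral\<^sup>L (lebesgue_on unit_square) h"
    using lebesgue_on_integral_cong_AE(2)[OF I outer eq]
    by (simp only: unit_pair.integral_fst'[OF G] intG)
qed

section \<open>The slice theorem\<close>

definition fourier_char :: "int \<times> int \<Rightarrow> real \<times> real \<Rightarrow> complex" where
  "fourier_char k x = exp (- 2 * complex_of_real pi * \<i> * complex_of_real (of_lattice k \<bullet> x))"

lemma norm_fourier_char [simp]: "norm (fourier_char k x) = 1"
  by (simp add: fourier_char_def)

lemma fourier_char_nonzero: "fourier_char k x \<noteq> 0"
  by (simp add: fourier_char_def)

lemma fourier_char_translate: "fourier_char k (x + of_lattice m) = fourier_char k x"
proof -
  have "fourier_char k (x + of_lattice m) = fourier_char k x *
      exp (complex_of_real (2 * of_int (- (fst k * fst m + snd k * snd m)) * pi) * \<i>)"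
    by (simp add: fourier_char_def of_lattice_def inner_prod_def ring_distribs algebra_simps
        flip: exp_add)
  then show ?thesis by (simp only: exp_integer_2pi[OF Ints_of_int] mult_1_right)
qed

lemma integrable_times_fourier_char:
  assumes "f \<in> L1_torus"
  shows "integrable (lebesgue_on unit_square) (\<lambda>x. f x * fourier_char k x)"
proof -
  have f: "integrable (lebesgue_on unit_square) f" using assms by (simp add: L1_torus_def)
  have "fourier_char k \<in> borel_measurable borel"
    unfolding fourier_char_def[abs_def]
    by (intro borel_measurable_continuous_onI continuous_intros)
  then have "fourier_char k \<in> borel_measurable (lebesgue_on unit_square)"
    by (intro measurable_restrict_space1 measurable_completion) simp
  then show ?thesis
    using f by (intro Bochner_Integration.integrable_bound[OF f] borel_measurable_times)
      (auto simp: norm_mult)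
qed

lemma lattice_periodic_frac:
  assumes "lattice_periodic h"
  shows "h (frac x, frac y) = h (x, y)"
proof -
  have "(x, y) = (frac x, frac y) + of_lattice (\<lfloor>x\<rfloor>, \<lfloor>y\<rfloor>)"
    by (simp add: of_lattice_def frac_def)
  then show ?thesis using assms unfolding lattice_periodic_def by metis
qed

text \<open>
  Here \<open>p\<close> parametrises the transversal of base points, and the line through \<open>p y\<close> in direction \<open>v\<close>
  is traced modulo the lattice by \<open>t \<mapsto> \<phi> (y, t)\<close>. Both the vertical and the horizontal transversal
  are instances.
\<close>

lemma projection_slice:
  fixes p :: "real \<Rightarrow> real \<times> real"
  assumes f: "f \<in> L1_torus" and vk: "orthogonal (of_lattice v) (of_lattice k)"
    and \<phi>: "\<phi> \<in> borel \<rightarrow>\<^sub>M borel"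
      "distr (lborel_on unit_square) borel \<phi> = lborel_on unit_square"
    and param: "\<And>h y t. lattice_periodic h \<Longrightarrow> h (\<phi> (y, t)) = h (p y + t *\<^sub>R of_lattice v)"
  shows "AE y in lebesgue_on {0..1}. xray_exists v f (p y)"
    and "integrable (lebesgue_on {0..1}) (\<lambda>y. xray v f (p y) * fourier_char k (p y))"
    and "fourier_coeff f k
      = (LINT y|lebesgue_on {0..1}. xray v f (p y) * fourier_char k (p y))"
proof -
  define h where "h x = f x * fourier_char k x" for x
  have "lattice_periodic h"
    using f by (simp add: h_def L1_torus_def lattice_periodic_def fourier_char_translate)
  have "of_lattice k \<bullet> (p y + t *\<^sub>R of_lattice v) = of_lattice k \<bullet> p y" for y t
    using vk by (simp add: inner_add_right orthogonal_def inner_commute)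
  then have "fourier_char k (p y + t *\<^sub>R of_lattice v) = fourier_char k (p y)" for y t
    by (simp add: fourier_char_def)
  then have line: "h (\<phi> (y, t)) = f (p y + t *\<^sub>R of_lattice v) * fourier_char k (p y)" for y t
    using param[OF \<open>lattice_periodic h\<close>] by (simp add: h_def)
  have inner: "(LINT t|lebesgue_on {0..1}. h (\<phi> (y, t))) = xray v f (p y) * fourier_char k (p y)" for y
    by (simp add: line xray_def)
  have h: "integrable (lebesgue_on unit_square) h"
    unfolding h_def using f by (rule integrable_times_fourier_char)
  note fub = fubini_measure_preserving[OF h \<phi>, unfolded inner]
  show "AE y in lebesgue_on {0..1}. xray_exists v f (p y)"
    \<comment> \<open>The character is a nonzero constant on each line, so it can be divided out.\<close>
    using fub(1)
  proof eventually_elim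
    case (elim y)
    then have "integrable (lebesgue_on {0..1})
        (\<lambda>t. f (p y + t *\<^sub>R of_lattice v) * fourier_char k (p y) * inverse (fourier_char k (p y)))"
      unfolding line by (rule integrable_mult_left)
    then show ?case by (simp add: xray_exists_def mult.assoc fourier_char_nonzero)
  qed
  show "integrable (lebesgue_on {0..1}) (\<lambda>y. xray v f (p y) * fourier_char k (p y))"
    by (rule fub(2))
  have "fourier_coeff f k = integral\<^sup>L (lebesgue_on unit_square) h"
    unfolding fourier_coeff_def h_def fourier_char_def ..
  then show "fourier_coeff f k
      = (LINT y|lebesgue_on {0..1}. xray v f (p y) * fourier_char k (p y))"
    by (simp only: fub(3))
qed

lemma projection_slice_vertical:
  assumes "f \<in> L1_torus" and "orthogonal (of_lattice v) (of_lattice k)" and "fst v \<noteq> 0"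
  shows "AE y in lebesgue_on {0..1}. xray_exists v f (0, y)"
    and "integrable (lebesgue_on {0..1}) (\<lambda>y. xray v f (0, y) * fourier_char k (0, y))"
    and "fourier_coeff f k = (LINT y|lebesgue_on {0..1}. xray v f (0, y) * fourier_char k (0, y))"
proof -
  note mp = skew_toral_map_measure_preserving[OF assms(3), of "snd v"]
  have "h (case (y, t) of (y, t) \<Rightarrow> (frac (of_int (fst v) * t), frac (y + of_int (snd v) * t)))
      = h ((0, y) + t *\<^sub>R of_lattice v)" if "lattice_periodic h" for h y t
    using that by (simp add: lattice_periodic_frac of_lattice_def mult.commute)
  note slice = projection_slice[OF assms(1,2) mp this]
  show "AE y in lebesgue_on {0..1}. xray_exists v f (0, y)" by (rule slice(1))
  show "integrable (lebesgue_on {0..1}) (\<lambda>y. xray v f (0, y) * fourier_char k (0, y))"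
    by (rule slice(2))
  show "fourier_coeff f k = (LINT y|lebesgue_on {0..1}. xray v f (0, y) * fourier_char k (0, y))"
    by (rule slice(3))
qed

lemma projection_slice_horizontal:
  assumes "f \<in> L1_torus" and "orthogonal (of_lattice v) (of_lattice k)" and "snd v \<noteq> 0"
  shows "AE x in lebesgue_on {0..1}. xray_exists v f (x, 0)"
    and "integrable (lebesgue_on {0..1}) (\<lambda>x. xray v f (x, 0) * fourier_char k (x, 0))"
    and "fourier_coeff f k = (LINT x|lebesgue_on {0..1}. xray v f (x, 0) * fourier_char k (x, 0))"
proof -
  define \<psi> :: "real \<times> real \<Rightarrow> real \<times> real" where "\<psi> = (\<lambda>(x, t). (frac (of_int (snd v) * t), frac (x + of_int (fst v) * t)))"
  have \<psi>[measurable]: "\<psi> \<in> borel \<rightarrow>\<^sub>M borel"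
    and distr: "distr (lborel_on unit_square) borel \<psi> = lborel_on unit_square"
    using skew_toral_map_measure_preserving[OF assms(3), of "fst v"] by (simp_all add: \<psi>_def)
  have swap[measurable]: "(prod.swap :: real \<times> real \<Rightarrow> _) \<in> borel \<rightarrow>\<^sub>M borel"
    by (intro borel_measurable_continuous_onI continuous_on_swap)
  have m: "(\<lambda>z. prod.swap (\<psi> z)) \<in> borel \<rightarrow>\<^sub>M borel" by measurable
  have "distr (lborel_on unit_square) borel (\<lambda>z. prod.swap (\<psi> z))
      = distr (distr (lborel_on unit_square) borel \<psi>) borel prod.swap"
    by (subst distr_distr) (simp_all add: comp_def)
  then have d: "distr (lborel_on unit_square) borel (\<lambda>z. prod.swap (\<psi> z)) = lborel_on unit_square"
    by (simp add: distr swap_measure_preserving)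
  have "h (prod.swap (\<psi> (x, t))) = h ((x, 0) + t *\<^sub>R of_lattice v)"
    if "lattice_periodic h" for h x t
    using that by (simp add: \<psi>_def lattice_periodic_frac of_lattice_def mult.commute)
  note slice = projection_slice[OF assms(1,2) m d this]
  show "AE x in lebesgue_on {0..1}. xray_exists v f (x, 0)" by (rule slice(1))
  show "integrable (lebesgue_on {0..1}) (\<lambda>x. xray v f (x, 0) * fourier_char k (x, 0))"
    by (rule slice(2))
  show "fourier_coeff f k = (LINT x|lebesgue_on {0..1}. xray v f (x, 0) * fourier_char k (x, 0))"
    by (rule slice(3))
qed

lemma fourier_char_axis:
  "fourier_char (k1, k2) (0, y) = exp (- 2 * complex_of_real pi * \<i> * of_int k2 * complex_of_real y)"
  "fourier_char (k1, k2) (x, 0) = exp (- 2 * complex_of_real pi * \<i> * of_int k1 * complex_of_real x)"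
  by (simp_all add: fourier_char_def of_lattice_def mult.assoc)

theorem theorem4p5:
  fixes f :: "real \<times> real \<Rightarrow> complex" and k1 k2 :: int
  assumes "f \<in> L1_torus"
  shows
    "((k1, k2) \<noteq> 0 \<longrightarrow>
       (\<forall>v. v \<noteq> 0 \<and> orthogonal (of_lattice v) (of_lattice (k1, k2)) \<longrightarrow>
         (k2 \<noteq> 0 \<longrightarrow>
            (AE y in lebesgue_on {0..1}. xray_exists v f (0, y)) \<and>
            integrable (lebesgue_on {0..1})
              (\<lambda>y. xray v f (0, y) * exp (- 2 * complex_of_real pi * \<i> * of_int k2 * complex_of_real y)) \<and>
            fourier_coeff f (k1, k2) =
              (LINT y|lebesgue_on {0..1}.
                 xray v f (0, y) * exp (- 2 * complex_of_real pi * \<i> * of_int k2 * complex_of_real y))) \<and>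
         (k1 \<noteq> 0 \<longrightarrow>
            (AE x in lebesgue_on {0..1}. xray_exists v f (x, 0)) \<and>
            integrable (lebesgue_on {0..1})
              (\<lambda>x. xray v f (x, 0) * exp (- 2 * complex_of_real pi * \<i> * of_int k1 * complex_of_real x)) \<and>
            fourier_coeff f (k1, k2) =
              (LINT x|lebesgue_on {0..1}.
                 xray v f (x, 0) * exp (- 2 * complex_of_real pi * \<i> * of_int k1 * complex_of_real x))))) \<and>
     ((k1, k2) = 0 \<longrightarrow>
        (AE y in lebesgue_on {0..1}. xray_exists (1, 0) f (0, y)) \<and>
        integrable (lebesgue_on {0..1}) (\<lambda>y. xray (1, 0) f (0, y)) \<and>
        (AE x in lebesgue_on {0..1}. xray_exists (0, 1) f (x, 0)) \<and>
        integrable (lebesgue_on {0..1}) (\<lambda>x. xray (0, 1) f (x, 0)) \<and>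
        fourier_coeff f (k1, k2) = (LINT y|lebesgue_on {0..1}. xray (1, 0) f (0, y)) \<and>
        (LINT y|lebesgue_on {0..1}. xray (1, 0) f (0, y)) =
          (LINT x|lebesgue_on {0..1}. xray (0, 1) f (x, 0)))"
proof (intro conjI impI allI)
  fix v :: "int \<times> int"
  assume v: "v \<noteq> 0 \<and> orthogonal (of_lattice v) (of_lattice (k1, k2))"
  then have vk: "orthogonal (of_lattice v) (of_lattice (k1, k2))" by simp
  then have "real_of_int (fst v * k1 + snd v * k2) = 0"
    by (simp add: orthogonal_def of_lattice_def)
  then have dot: "fst v * k1 + snd v * k2 = 0" by (simp only: of_int_eq_0_iff)
  {
    assume "k2 \<noteq> 0"
    \<comment> \<open>If \<open>fst v = 0\<close>, then \<open>snd v * k2 = 0\<close>, which would force \<open>v = 0\<close>.\<close>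
    then have "fst v \<noteq> 0" using v dot by (auto simp: prod_eq_iff)
    note slice = projection_slice_vertical[OF assms vk this, unfolded fourier_char_axis]
    show "AE y in lebesgue_on {0..1}. xray_exists v f (0, y)" by (rule slice(1))
    show "integrable (lebesgue_on {0..1})
        (\<lambda>y. xray v f (0, y) * exp (- 2 * complex_of_real pi * \<i> * of_int k2 * complex_of_real y))"
      by (rule slice(2))
    show "fourier_coeff f (k1, k2) = (LINT y|lebesgue_on {0..1}.
        xray v f (0, y) * exp (- 2 * complex_of_real pi * \<i> * of_int k2 * complex_of_real y))"
      by (rule slice(3))
  next
    assume "k1 \<noteq> 0"
    then have "snd v \<noteq> 0" using v dot by (auto simp: prod_eq_iff)
    note slice = projection_slice_horizontal[OF assms vk this, unfolded fourier_char_axis]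
    show "AE x in lebesgue_on {0..1}. xray_exists v f (x, 0)" by (rule slice(1))
    show "integrable (lebesgue_on {0..1})
        (\<lambda>x. xray v f (x, 0) * exp (- 2 * complex_of_real pi * \<i> * of_int k1 * complex_of_real x))"
      by (rule slice(2))
    show "fourier_coeff f (k1, k2) = (LINT x|lebesgue_on {0..1}.
        xray v f (x, 0) * exp (- 2 * complex_of_real pi * \<i> * of_int k1 * complex_of_real x))"
      by (rule slice(3))
  }
next
  assume "(k1, k2) = 0"
  then have k: "k1 = 0" "k2 = 0" by (simp_all add: zero_prod_def)
  have ort: "orthogonal (of_lattice v) (of_lattice (k1, k2))" for v
    by (simp add: k orthogonal_def of_lattice_def)
  note ver = projection_slice_vertical[OF assms ort, of "(1, 0)", unfolded fourier_char_axis]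
  note hor = projection_slice_horizontal[OF assms ort, of "(0, 1)", unfolded fourier_char_axis]
  show "AE y in lebesgue_on {0..1}. xray_exists (1, 0) f (0, y)" using ver(1) by simp
  show "AE x in lebesgue_on {0..1}. xray_exists (0, 1) f (x, 0)" using hor(1) by simp
  show "integrable (lebesgue_on {0..1}) (\<lambda>y. xray (1, 0) f (0, y))" using ver(2) by (simp add: k)
  show "integrable (lebesgue_on {0..1}) (\<lambda>x. xray (0, 1) f (x, 0))" using hor(2) by (simp add: k)
  show "fourier_coeff f (k1, k2) = (LINT y|lebesgue_on {0..1}. xray (1, 0) f (0, y))"
    using ver(3) by (simp add: k)
  then show "(LINT y|lebesgue_on {0..1}. xray (1, 0) f (0, y))
      = (LINT x|lebesgue_on {0..1}. xray (0, 1) f (x, 0))"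
    using hor(3) by (simp add: k)
qed

end
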